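(* Let $p$ be a prime, $k$ a positive integer, and let $G$ be a finite group of conjugate type $(p^k,1)$. If $\left|\frac{G}{Z(G)}\right| > p^{2k}$, then the centralizer $C(x)$ is non-abelian for every $x \in G\setminus Z(G)$.
   Context: $C(x)$ is the centralizer of $x$ in $G$ and $Z(G)$ is the center of $G$. A finite group $G$ is of conjugate type $(m,1)$ if every proper centralizer $C(x)$, $x\in G\setminus Z(G)$, has index $m$ in $G$. *)

theory Defs
  imports "HOL-Algebra.Coset" "HOL-Computational_Algebra.Primes"
begin

definition centralizer :: "('a, 'b) monoid_scheme \<Rightarrow> 'a \<Rightarrow> 'a set"
  where "centralizer G x = {g \<in> carrier G. g \<otimes>\<^bsub>G\<^esub> x = x \<otimes>\<^bsub>G\<^esub> g}"

definition center :: "('a, 'b) monoid_scheme \<Rightarrow> 'a set"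
  where "center G = {z \<in> carrier G. \<forall>g \<in> carrier G. z \<otimes>\<^bsub>G\<^esub> g = g \<otimes>\<^bsub>G\<^esub> z}"

definition subgroup_index :: "('a, 'b) monoid_scheme \<Rightarrow> 'a set \<Rightarrow> nat"
  where "subgroup_index G H = card (rcosets\<^bsub>G\<^esub> H)"

text \<open>Conjugate type $(m,1)$, for a finite group. The condition is vacuous for abelian groups, which
  therefore have conjugate type $(m,1)$ for every $m$.\<close>

definition conjugate_type :: "('a, 'b) monoid_scheme \<Rightarrow> nat \<Rightarrow> bool"
  where "conjugate_type G m \<longleftrightarrow>
    (\<forall>x \<in> carrier G - center G. subgroup_index G (centralizer G x) = m)"

lemma (in group) subgroup_centralizer:
  assumes x: "x \<in> carrier G"
  shows "subgroup (centralizer G x) G"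
proof (rule subgroupI)
  show "centralizer G x \<subseteq> carrier G"
    by (auto simp: centralizer_def)
  show "centralizer G x \<noteq> {}"
    using x by (auto simp: centralizer_def)
next
  fix a assume "a \<in> centralizer G x"
  then have a: "a \<in> carrier G" "a \<otimes> x = x \<otimes> a"
    by (auto simp: centralizer_def)
  have "inv a \<otimes> x = inv a \<otimes> (x \<otimes> a) \<otimes> inv a"
    using a(1) x by (simp add: m_assoc)
  also have "\<dots> = x \<otimes> inv a"
    using a(1) x by (simp flip: a(2) add: m_assoc[symmetric])
  finally show "inv a \<in> centralizer G x"
    using a(1) by (simp add: centralizer_def)
next
  fix a b assume "a \<in> centralizer G x" "b \<in> centralizer G x"
  then have a: "a \<in> carrier G" "a \<otimes> x = x \<otimes> a" and b: "b \<in> carrier G" "b \<otimes> x = x \<otimes> b"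
    by (auto simp: centralizer_def)
  have "a \<otimes> b \<otimes> x = a \<otimes> x \<otimes> b"
    using a(1) b x by (simp add: m_assoc)
  also have "\<dots> = x \<otimes> (a \<otimes> b)"
    using a b(1) x by (simp add: m_assoc)
  finally show "a \<otimes> b \<in> centralizer G x"
    using a(1) b(1) by (simp add: centralizer_def)
qed

lemma (in group) center_eq_Inter_centralizer:
  "center G = (\<Inter>x \<in> carrier G. centralizer G x)"
  using one_closed by (auto simp: center_def centralizer_def)

lemma (in group) normal_center: "center G \<lhd> G"
proof -
  have "subgroup (center G) G"
    unfolding center_eq_Inter_centralizer
    by (rule subgroups_Inter) (auto intro: subgroup_centralizer)
  moreover have "x \<otimes> z \<otimes> inv x \<in> center G" if "x \<in> carrier G" "z \<in> center G" for x z
  proof -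
    have z: "z \<in> carrier G" "x \<otimes> z = z \<otimes> x"
      using that by (auto simp: center_def)
    then have "x \<otimes> z \<otimes> inv x = z"
      using that(1) by (simp add: m_assoc)
    with that show ?thesis by simp
  qed
  ultimately show ?thesis
    by (simp add: normal_inv_iff)
qed

end

theory Submission
  imports Defs
begin

text \<open>Suppose that \<open>A = C(x)\<close> is abelian for some non-central \<open>x\<close>, and write \<open>m\<close> for the common index
  of the proper centralizers. Every non-central \<open>a \<in> A\<close> has \<open>A \<subseteq> C(a)\<close> because \<open>A\<close> is abelian, and
  the two subgroups have the same index, so \<open>C(a) = A\<close>. As \<open>x\<close> is not central, there is some
  \<open>y \<notin> A\<close>; an element of \<open>A \<inter> C(y)\<close> outside the center \<open>Z\<close> would have \<open>y\<close> in its centralizer \<open>A\<close>,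
  so \<open>A \<inter> C(y) = Z\<close>. Since the index of an intersection is at most the product of the indices
  (\<open>index_Int_le\<close>), \<open>\<bar>G/Z\<bar> \<le> m\<^sup>2\<close>, and for \<open>m = p\<^sup>k\<close> this contradicts the hypothesis.\<close>

lemma (in group) r_coset_Int:
  assumes "H \<subseteq> carrier G" "K \<subseteq> carrier G" "g \<in> carrier G"
  shows "(H \<inter> K) #> g = (H #> g) \<inter> (K #> g)"
proof
  show "(H #> g) \<inter> (K #> g) \<subseteq> (H \<inter> K) #> g"
  proof
    fix z assume "z \<in> (H #> g) \<inter> (K #> g)"
    then obtain h l where "h \<in> H" "z = h \<otimes> g" "l \<in> K" "z = l \<otimes> g"
      by (auto simp: r_coset_def)
    moreover from this have "h = l"
      using assms right_cancel by blast
    ultimately show "z \<in> (H \<inter> K) #> g"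
      by (auto simp: r_coset_def)
  qed
qed (auto simp: r_coset_def)

text \<open>A coset of \<open>H \<inter> K\<close> is the intersection of a coset of \<open>H\<close> and a coset of \<open>K\<close>, so there are at
  most as many of them as there are pairs of such cosets.\<close>

lemma (in group) index_Int_le:
  assumes "finite (carrier G)" "H \<subseteq> carrier G" "K \<subseteq> carrier G"
  shows "subgroup_index G (H \<inter> K) \<le> subgroup_index G H * subgroup_index G K"
proof -
  have fin: "finite (rcosets H)" "finite (rcosets K)"
    using assms(1) by (auto simp: RCOSETS_def)
  have "rcosets (H \<inter> K) \<subseteq> (\<lambda>(A, B). A \<inter> B) ` ((rcosets H) \<times> (rcosets K))"
  proof
    fix C assume "C \<in> rcosets (H \<inter> K)"
    then obtain g where "g \<in> carrier G" "C = (H #> g) \<inter> (K #> g)"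
      using r_coset_Int[OF assms(2,3)] by (auto simp: RCOSETS_def)
    then show "C \<in> (\<lambda>(A, B). A \<inter> B) ` ((rcosets H) \<times> (rcosets K))"
      using assms(2,3) rcosetsI by (intro image_eqI[of _ _ "(H #> g, K #> g)"]) auto
  qed
  then have "card (rcosets (H \<inter> K)) \<le> card ((rcosets H) \<times> (rcosets K))"
    using fin by (meson card_image_le card_mono finite_SigmaI finite_imageI order_trans)
  then show ?thesis
    by (simp add: subgroup_index_def card_cartesian_product)
qed

lemma (in group) subgroup_eq_if_index_eq:
  assumes "finite (carrier G)" "subgroup H G" "subgroup K G" "H \<subseteq> K"
    and "subgroup_index G H = subgroup_index G K"
  shows "H = K"
proof -
  have "subgroup_index G K * card H = subgroup_index G K * card K" "subgroup_index G K * card K > 0"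
    using lagrange[OF assms(2)] lagrange[OF assms(3)] assms(1,5) order_gt_0_iff_finite
    by (simp_all add: subgroup_index_def)
  then have "card H = card K" by simp
  moreover have "finite K"
    using assms(1,3) by (meson finite_subset subgroup.subset)
  ultimately show ?thesis
    using assms(4) by (simp add: card_subset_eq)
qed

lemma (in group) order_Mod_center_le_if_abelian_centralizer:
  assumes fin: "finite (carrier G)" and type: "conjugate_type G m"
    and x: "x \<in> carrier G - center G"
    and comm: "comm_group (G\<lparr>carrier := centralizer G x\<rparr>)"
  shows "order (G Mod center G) \<le> m ^ 2"
proof -
  let ?A = "centralizer G x"
  have index: "subgroup_index G (centralizer G a) = m" if "a \<in> carrier G - center G" for a
    using type that by (simp add: conjugate_type_def)
  have A_commute: "a \<otimes> b = b \<otimes> a" if "a \<in> ?A" "b \<in> ?A" for a b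
    using comm_monoid.m_comm[OF comm_group.axioms(1)[OF comm]] that by simp
  have same: "centralizer G a = ?A" if a: "a \<in> ?A" "a \<notin> center G" for a
  proof -
    have aG: "a \<in> carrier G" using a by (simp add: centralizer_def)
    have "?A \<subseteq> centralizer G a"
      using A_commute a by (auto simp: centralizer_def)
    then show ?thesis
      using subgroup_eq_if_index_eq[OF fin subgroup_centralizer subgroup_centralizer] index a aG x
      by (metis DiffD1 DiffI)
  qed
  obtain y where y: "y \<in> carrier G" "y \<notin> ?A"
    using x by (auto simp: center_def centralizer_def)
  have "y \<notin> center G"
    using x y by (auto simp: center_def centralizer_def)
  have "?A \<inter> centralizer G y = center G"
  proof
    show "?A \<inter> centralizer G y \<subseteq> center G"
    proof (rule subsetI, rule ccontr)
      fix a assume a: "a \<in> ?A \<inter> centralizer G y" "a \<notin> center G"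
      then have "y \<in> centralizer G a"
        using y by (simp add: centralizer_def)
      then show False
        using same a y by blast
    qed
    show "center G \<subseteq> ?A \<inter> centralizer G y"
      using x y by (auto simp: center_eq_Inter_centralizer)
  qed
  then have "subgroup_index G (center G) \<le> m * m"
    using index_Int_le[OF fin, of ?A "centralizer G y"] index x y \<open>y \<notin> center G\<close>
    by (auto simp: centralizer_def)
  then show ?thesis
    by (simp add: order_def FactGroup_def subgroup_index_def power2_eq_square)
qed

theorem proposition2p26:
  fixes G (structure) and p k :: nat
  assumes "group G" and "finite (carrier G)"
    and "prime p" and "k > 0"
    and "conjugate_type G (p ^ k)"
    and "order (G Mod center G) > p ^ (2 * k)"
  shows "\<forall>x \<in> carrier G - center G. \<not> comm_group (G\<lparr>carrier := centralizer G x\<rparr>)"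
proof (intro ballI notI)
  fix x assume "x \<in> carrier G - center G" "comm_group (G\<lparr>carrier := centralizer G x\<rparr>)"
  then have "order (G Mod center G) \<le> (p ^ k) ^ 2"
    by (rule group.order_Mod_center_le_if_abelian_centralizer[OF assms(1,2,5)])
  then show False
    using assms(6) by (simp add: power_mult power2_eq_square mult_2 power_add)
qed

end
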